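(* Let $c_0>0$, $0<\alpha_1<1$, $\gamma\in(0,2)$, and for $\vec k\in\mathbb{R}^3$ let $A(\vec k)=-\alpha_1c_0|\vec k|^\gamma$ and $B(\vec k)=c_0\sqrt{|\vec k|^2-\alpha_1^2|\vec k|^{2\gamma}}$. Define $$\mathcal{G}(\vec x,t)=\frac{H(t)c_0^2}{(2\pi)^{3/2}}\,\mathcal{F}_{3D}\left\{e^{A(\cdot)t}\frac{\sin(B(\cdot)t)}{B(\cdot)}\right\}(\vec x).$$ Then there does not exist a constant $c>0$ such that $\mathrm{supp}(\mathcal{G}(\cdot,t))\subseteq B_{ct}(\mathbf 0)$ for all $t>0$; i.e. for each $c>0$ the function $t\mapsto\mathcal{G}(\vec x,t+|\vec x|/c)$ is not causal.
   Context: $\mathcal{F}_{3D}\{f\}(\vec x)=\frac{1}{(2\pi)^{3/2}}\int_{\mathbb{R}^3}e^{i\vec x\cdot\vec k}f(\vec k)\,d\vec k$; $H$ is the Heaviside function; $B_R(\mathbf 0)$ is the open ball of radius $R$ centered at the origin; the square root is the complex root with non-negative real part. A function of $t$ is causal if it vanishes for $t<0$. *)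

theory Defs
  imports "HOL-Analysis.Analysis"
begin

definition F3D :: "(real^3 \<Rightarrow> complex) \<Rightarrow> real^3 \<Rightarrow> complex" where
  "F3D f x = complex_of_real (1 / (2 * pi) powr (3/2)) *
     (LINT k|lborel. exp (\<i> * complex_of_real (x \<bullet> k)) * f k)"

text \<open>Heaviside function (value at 0 is irrelevant here).\<close>
definition heaviside :: "real \<Rightarrow> real" where
  "heaviside t = (if t \<ge> 0 then 1 else 0)"

definition symA :: "real \<Rightarrow> real \<Rightarrow> real \<Rightarrow> real^3 \<Rightarrow> complex" where
  "symA c0 \<alpha>1 \<gamma> k = complex_of_real (- \<alpha>1 * c0 * norm k powr \<gamma>)"

definition symB :: "real \<Rightarrow> real \<Rightarrow> real \<Rightarrow> real^3 \<Rightarrow> complex" where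
  "symB c0 \<alpha>1 \<gamma> k = complex_of_real c0 *
     csqrt (complex_of_real (norm k ^ 2 - \<alpha>1 ^ 2 * norm k powr (2 * \<gamma>)))"

text \<open>sin(B t)/B, continuously extended by t where B = 0.\<close>
definition sin_over :: "complex \<Rightarrow> real \<Rightarrow> complex" where
  "sin_over b t = (if b = 0 then complex_of_real t else sin (b * complex_of_real t) / b)"

definition greenG :: "real \<Rightarrow> real \<Rightarrow> real \<Rightarrow> real^3 \<Rightarrow> real \<Rightarrow> complex" where
  "greenG c0 \<alpha>1 \<gamma> x t =
     complex_of_real (heaviside t * c0 ^ 2 / (2 * pi) powr (3/2)) *
     F3D (\<lambda>k. exp (symA c0 \<alpha>1 \<gamma> k * complex_of_real t) * sin_over (symB c0 \<alpha>1 \<gamma> k) t) x"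

end

(*
Suppose G(., 1) vanishes outside a ball of radius c. The symbol f(k) = exp(A(k)) sin(B(k))/B(k) is
continuous, and it is integrable: where B is imaginary, exp(A) sinh|B|/|B| <= exp(-(|A| - |B|)) and
|A|^2 - |B|^2 = c0^2 |k|^2 leaves decay of order exp(-C |k|^(2 - gamma)). So Fourier inversion
(here with Gaussian regularization) recovers f from its compactly supported, bounded transform,
whence |f(k) + f(-k) - 2 f(0)| <= C |k|^2. But f is even and f(0) - f(k) >= alpha1 c0 |k|^gamma / 4
near the origin, which contradicts gamma < 2.
*)

theory Submission
  imports Defs "HOL-Probability.Probability"
begin

section \<open>Change of variables and product integrals for Lebesgue measure\<close>

text \<open>Lebesgue measure is \<open>\<bar>c\<bar> ^ DIM('a)\<close> times its own image under
  \<open>x \<mapsto> t + c x\<close>, so both claims reduce to the rules for densities and image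
  measures.\<close>

lemma lborel_affine_transfer:
  fixes f :: "'a::euclidean_space \<Rightarrow> 'b::{banach, second_countable_topology}"
  assumes "c \<noteq> 0" and [measurable]: "f \<in> borel_measurable borel"
  shows lborel_integral_affine:
      "(LINT x|lborel. f x) = \<bar>c\<bar> ^ DIM('a) *\<^sub>R (LINT x|lborel. f (t + c *\<^sub>R x))"
    and lborel_integrable_affine:
      "integrable lborel f \<Longrightarrow> integrable lborel (\<lambda>x. f (t + c *\<^sub>R x))"
proof -
  let ?D = "distr lborel borel (\<lambda>x. t + c *\<^sub>R x)"
  have eq: "(lborel :: 'a measure) = density ?D (\<lambda>_. ennreal (\<bar>c\<bar> ^ DIM('a)))"
    using lborel_affine[OF assms(1), of t] by simp
  have m: "f \<in> borel_measurable ?D"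
    by simp
  have "(LINT x|lborel. f x) = (LINT x|?D. \<bar>c\<bar> ^ DIM('a) *\<^sub>R f x)"
    unfolding arg_cong[OF eq, of "\<lambda>M. integral\<^sup>L M f"] by (rule integral_density[OF m]) auto
  also have "\<dots> = \<bar>c\<bar> ^ DIM('a) *\<^sub>R (LINT x|lborel. f (t + c *\<^sub>R x))"
    by (subst integral_distr) simp_all
  finally show "(LINT x|lborel. f x) = \<dots>" .
  have "integrable lborel f \<longleftrightarrow> integrable ?D (\<lambda>x. \<bar>c\<bar> ^ DIM('a) *\<^sub>R f x)"
    unfolding arg_cong[OF eq, of "\<lambda>M. integrable M f"] by (rule integrable_density[OF m]) auto
  also have "\<dots> \<longleftrightarrow> integrable lborel (\<lambda>x. \<bar>c\<bar> ^ DIM('a) *\<^sub>R f (t + c *\<^sub>R x))"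
    by (subst integrable_distr_eq) simp_all
  finally have iff: "integrable lborel f \<longleftrightarrow> \<dots>" .
  show "integrable lborel (\<lambda>x. f (t + c *\<^sub>R x))" if f: "integrable lborel f"
  proof -
    \<comment> \<open>The equivalence \<open>iff\<close> leaves the Jacobian inside the integrand;
      its inverse is multiplied in to cancel it.\<close>
    have "integrable lborel (\<lambda>x. inverse (\<bar>c\<bar> ^ DIM('a)) *\<^sub>R \<bar>c\<bar> ^ DIM('a) *\<^sub>R f (t + c *\<^sub>R x))"
      by (rule integrable_scaleR_right) (use f in \<open>simp only: iff\<close>)
    then show ?thesis
      using assms(1) by simp
  qed
qed

text \<open>Lebesgue measure on a Euclidean space is the image of a finite product of
  one-dimensional Lebesgue measures, so Fubini for finite products applies coordinate by
  coordinate.\<close>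

lemma
  fixes f :: "'a::euclidean_space \<Rightarrow> real \<Rightarrow> 'b::{real_normed_field, banach, second_countable_topology}"
  assumes f: "\<And>b. b \<in> Basis \<Longrightarrow> integrable lborel (f b)"
  shows integrable_lborel_prod: "integrable lborel (\<lambda>x::'a. \<Prod>b\<in>Basis. f b (x \<bullet> b))"
    and integral_lborel_prod:
      "(LINT x|lborel. (\<Prod>b\<in>Basis. f b (x \<bullet> b))) = (\<Prod>b\<in>Basis. LINT y|lborel. f b y)"
proof -
  interpret product_sigma_finite "\<lambda>_::'a. lborel :: real measure" ..
  have [measurable]: "f b \<in> borel_measurable borel" if "b \<in> Basis" for b
    using borel_measurable_integrable[OF f[OF that]] by simp
  have coord: "(\<Sum>b\<in>Basis. y b *\<^sub>R b) \<bullet> i = y i" if "i \<in> Basis" for i :: 'a and y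
    using that by (simp add: inner_sum_left inner_Basis if_distrib sum.delta cong: if_cong)
  show "integrable lborel (\<lambda>x::'a. \<Prod>b\<in>Basis. f b (x \<bullet> b))"
    using product_integrable_prod[OF finite_Basis f]
    by (subst lborel_eq) (simp add: integrable_distr_eq coord)
  show "(LINT x|lborel. (\<Prod>b\<in>Basis. f b (x \<bullet> b))) = (\<Prod>b\<in>Basis. LINT y|lborel. f b y)"
    using product_integral_prod[OF finite_Basis f]
    by (subst lborel_eq) (simp add: integral_distr coord)
qed

section \<open>Fourier transform of the Gaussian\<close>

text \<open>Up to the factor \<open>sqrt (2 * pi)\<close> the Gaussian is the standard normal
  density, whose characteristic function is known.\<close>

lemma
  shows integrable_iexp_gauss_real:
      "integrable lborel (\<lambda>x::real. iexp (t * x) * complex_of_real (exp (- (x\<^sup>2) / 2)))"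
    and integral_iexp_gauss_real:
      "(LINT x|lborel. iexp (t * x) * complex_of_real (exp (- (x\<^sup>2) / 2)))
        = complex_of_real (sqrt (2 * pi) * exp (- (t\<^sup>2) / 2))"
proof -
  have d: "std_normal_density x = exp (- (x\<^sup>2) / 2) / sqrt (2 * pi)" for x
    by (simp add: normal_density_def)
  have e: "complex_of_real (exp (- (x\<^sup>2) / 2)) = complex_of_real (sqrt (2 * pi)) * complex_of_real (std_normal_density x)" for x
    unfolding d by simp
  have i: "integrable lborel (\<lambda>x. complex_of_real (std_normal_density x))"
    by (rule integrable_of_real) (auto intro: integrable_normal_density)
  have "integrable lborel (\<lambda>x. iexp (t * x) * complex_of_real (std_normal_density x))"
    by (rule Bochner_Integration.integrable_bound[OF i]) (auto simp: norm_mult)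
  from integrable_mult_right[OF this, of "complex_of_real (sqrt (2 * pi))"]
  show "integrable lborel (\<lambda>x::real. iexp (t * x) * complex_of_real (exp (- (x\<^sup>2) / 2)))"
    unfolding e by (simp add: mult_ac)
  have "char std_normal_distribution t = (LINT x|lborel. std_normal_density x *\<^sub>R iexp (t * x))"
    unfolding char_def by (subst integral_density) auto
  then have "(LINT x|lborel. iexp (t * x) * complex_of_real (std_normal_density x)) = complex_of_real (exp (- (t\<^sup>2) / 2))"
    by (simp add: char_std_normal_distribution scaleR_conv_of_real mult_ac)
  moreover have "(LINT x|lborel. iexp (t * x) * complex_of_real (exp (- (x\<^sup>2) / 2)))
      = complex_of_real (sqrt (2 * pi)) * (LINT x|lborel. iexp (t * x) * complex_of_real (std_normal_density x))"
    unfolding e by (simp add: mult.left_commute)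
  ultimately show "(LINT x|lborel. iexp (t * x) * complex_of_real (exp (- (x\<^sup>2) / 2)))
        = complex_of_real (sqrt (2 * pi) * exp (- (t\<^sup>2) / 2))"
    by simp
qed

text \<open>Both \<open>(norm x)\<^sup>2\<close> and \<open>x \<bullet> m\<close> are sums over
  coordinates, so the integrand factors into one-dimensional ones.\<close>

lemma
  fixes m :: "'a::euclidean_space"
  shows integrable_iexp_gauss:
      "integrable lborel (\<lambda>x. iexp (x \<bullet> m) * complex_of_real (exp (- (norm x)\<^sup>2 / 2)))"
    and integral_iexp_gauss:
      "(LINT x|lborel. iexp (x \<bullet> m) * complex_of_real (exp (- (norm x)\<^sup>2 / 2)))
        = complex_of_real (sqrt (2 * pi) ^ DIM('a) * exp (- (norm m)\<^sup>2 / 2))"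
proof -
  have "(norm x)\<^sup>2 = (\<Sum>b\<in>Basis. (x \<bullet> b)\<^sup>2)" for x :: 'a
    unfolding power2_norm_eq_inner by (subst euclidean_inner) (simp add: power2_eq_square)
  then have g: "exp (- (norm x)\<^sup>2 / 2) = (\<Prod>b\<in>Basis. exp (- (x \<bullet> b)\<^sup>2 / 2))" for x :: 'a
    by (simp add: exp_sum[symmetric] sum_negf sum_divide_distrib[symmetric])
  have "x \<bullet> m = (\<Sum>b\<in>Basis. (m \<bullet> b) * (x \<bullet> b))" for x :: 'a
    using euclidean_inner[of x m] by (simp add: mult.commute)
  then have i: "iexp (x \<bullet> m) = (\<Prod>b\<in>Basis. iexp ((m \<bullet> b) * (x \<bullet> b)))" for x :: 'a
    by (simp add: sum_distrib_left exp_sum)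
  have eq: "iexp (x \<bullet> m) * complex_of_real (exp (- (norm x)\<^sup>2 / 2))
      = (\<Prod>b\<in>Basis. iexp ((m \<bullet> b) * (x \<bullet> b)) * complex_of_real (exp (- (x \<bullet> b)\<^sup>2 / 2)))" for x
    unfolding g i by (simp add: prod.distrib)
  show "integrable lborel (\<lambda>x. iexp (x \<bullet> m) * complex_of_real (exp (- (norm x)\<^sup>2 / 2)))"
    unfolding eq by (rule integrable_lborel_prod) (rule integrable_iexp_gauss_real)
  show "(LINT x|lborel. iexp (x \<bullet> m) * complex_of_real (exp (- (norm x)\<^sup>2 / 2)))
        = complex_of_real (sqrt (2 * pi) ^ DIM('a) * exp (- (norm m)\<^sup>2 / 2))"
  proof -
    have "(LINT x|lborel. iexp (x \<bullet> m) * complex_of_real (exp (- (norm x)\<^sup>2 / 2)))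
      = (\<Prod>b\<in>Basis. complex_of_real (sqrt (2 * pi) * exp (- (m \<bullet> b)\<^sup>2 / 2)))"
      unfolding eq integral_iexp_gauss_real[symmetric]
      by (rule integral_lborel_prod) (rule integrable_iexp_gauss_real)
    then show ?thesis
      unfolding g by (simp add: prod.distrib)
  qed
qed

lemma integrable_gauss:
  "integrable lborel (\<lambda>x::'a::euclidean_space. exp (- (norm x)\<^sup>2 / 2))"
  using integrable_Re[OF integrable_iexp_gauss[of 0]] by simp

text \<open>The substitution \<open>x \<mapsto> s x\<close> in the unscaled formula moves the scale
  to the frequency \<open>m /\<^sub>R s\<close>; the Jacobian puts \<open>s\<close> under
  \<open>sqrt (2 * pi)\<close> in each dimension.\<close>

lemma integral_iexp_scaled_gauss:
  fixes m :: "'a::euclidean_space"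
  assumes "s > 0"
  shows "(LINT x|lborel. iexp (x \<bullet> m) * complex_of_real (exp (- (norm (s *\<^sub>R x))\<^sup>2 / 2)))
      = complex_of_real ((sqrt (2 * pi) / s) ^ DIM('a) * exp (- (norm (m /\<^sub>R s))\<^sup>2 / 2))"
proof -
  define g where "g x = iexp (x \<bullet> (m /\<^sub>R s)) * complex_of_real (exp (- (norm x)\<^sup>2 / 2))" for x :: 'a
  have g: "g \<in> borel_measurable borel"
    unfolding g_def by measurable
  have "(LINT x|lborel. g x) = s ^ DIM('a) *\<^sub>R (LINT x|lborel. g (0 + s *\<^sub>R x))"
    using lborel_integral_affine[OF _ g, of s 0] assms by simp
  moreover have "g (0 + s *\<^sub>R x) = iexp (x \<bullet> m) * complex_of_real (exp (- (norm (s *\<^sub>R x))\<^sup>2 / 2))" for x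
  proof -
    have "(s *\<^sub>R x) \<bullet> (m /\<^sub>R s) = x \<bullet> m"
      using assms by simp
    then show ?thesis
      by (simp only: g_def add_0)
  qed
  moreover have "(LINT x|lborel. g x)
      = complex_of_real (sqrt (2 * pi) ^ DIM('a) * exp (- (norm (m /\<^sub>R s))\<^sup>2 / 2))"
    unfolding g_def by (rule integral_iexp_gauss)
  ultimately show ?thesis
    using assms by (simp add: scaleR_conv_of_real field_simps)
qed

lemma integrable_scaled_gauss:
  assumes "s > 0"
  shows "integrable lborel (\<lambda>x::'a::euclidean_space. exp (- (norm (s *\<^sub>R x))\<^sup>2 / 2))"
  using lborel_integrable_affine[OF _ _ integrable_gauss, of s 0] assms by simp

section \<open>Fourier inversion with Gaussian regularization\<close>

text \<open>The transform of \<open>f\<close> need not be integrable, but the Gaussian weight makes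
  the double integral absolutely convergent. Exchanging the order turns the inner integral over
  \<open>x\<close> into a Gaussian of width \<open>s\<close> around \<open>k\<close>, so the result
  is a Gaussian mean of \<open>f\<close>.\<close>

lemma fourier_gauss_summation:
  fixes f :: "'a::euclidean_space \<Rightarrow> complex"
  assumes f: "integrable lborel f" and s: "s > 0"
  shows "(LINT x|lborel. (LINT l|lborel. iexp (x \<bullet> l) * f l) *
            (iexp (- (x \<bullet> k)) * complex_of_real (exp (- (norm (s *\<^sub>R x))\<^sup>2 / 2))))
      = complex_of_real (sqrt (2 * pi) ^ DIM('a)) *
          (LINT u|lborel. f (k + s *\<^sub>R u) * complex_of_real (exp (- (norm u)\<^sup>2 / 2)))"
proof -
  have fm [measurable]: "f \<in> borel_measurable borel"
    using borel_measurable_integrable[OF f] by simp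
  define h where "h x = exp (- (norm (s *\<^sub>R x))\<^sup>2 / 2)" for x :: 'a
  have h: "integrable lborel h"
    unfolding h_def by (rule integrable_scaled_gauss[OF s])
  have hm [measurable]: "h \<in> borel_measurable borel"
    unfolding h_def by measurable
  define K where "K x l = iexp (x \<bullet> (l - k)) * complex_of_real (h x) * f l" for x l :: 'a
  \<comment> \<open>The modulus separates the variables, which is what makes Fubini
    applicable.\<close>
  have nK: "norm (K x l) = h x * norm (f l)" for x l
    by (simp add: K_def norm_mult h_def)
  have K: "integrable (lborel \<Otimes>\<^sub>M lborel) (case_prod K)"
  proof (rule lborel_pair.Fubini_integrable)
    show "case_prod K \<in> borel_measurable (lborel \<Otimes>\<^sub>M lborel)"
      unfolding K_def by measurable
    show "integrable lborel (\<lambda>x. LINT l|lborel. norm (case_prod K (x, l)))"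
      using h by (simp add: nK)
    have "integrable lborel (K x)" for x
    proof (rule Bochner_Integration.integrable_bound[OF integrable_mult_right[OF f, of "complex_of_real (h x)"]])
      show "K x \<in> borel_measurable lborel"
        unfolding K_def by measurable
    qed (simp add: nK norm_mult h_def)
    then show "AE x in lborel. integrable lborel (\<lambda>l. case_prod K (x, l))"
      by simp
  qed
  have "(LINT x|lborel. (LINT l|lborel. iexp (x \<bullet> l) * f l) *
            (iexp (- (x \<bullet> k)) * complex_of_real (h x)))
      = (LINT x|lborel. LINT l|lborel. K x l)"
    by (subst integral_mult_left_zero[symmetric])
       (simp add: K_def[abs_def] inner_diff_right right_diff_distrib exp_diff exp_minus divide_inverse mult_ac)
  also have "\<dots> = (LINT l|lborel. LINT x|lborel. K x l)"
    by (rule lborel_pair.Fubini_integral[OF K, symmetric])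
  also have "(\<lambda>l. LINT x|lborel. K x l) = (\<lambda>l. f l *
      complex_of_real ((sqrt (2 * pi) / s) ^ DIM('a) * exp (- (norm ((l - k) /\<^sub>R s))\<^sup>2 / 2)))"
    unfolding K_def integral_mult_left_zero h_def integral_iexp_scaled_gauss[OF s]
    by (simp add: mult.commute)
  \<comment> \<open>Substitution \<open>l = k + s u\<close>; its Jacobian will cancel the powers of
    \<open>s\<close> in the Gaussian constant.\<close>
  also have "integral\<^sup>L lborel \<dots> = s ^ DIM('a) *\<^sub>R (LINT u|lborel. f (k + s *\<^sub>R u) *
      complex_of_real ((sqrt (2 * pi) / s) ^ DIM('a) * exp (- (norm (((k + s *\<^sub>R u) - k) /\<^sub>R s))\<^sup>2 / 2)))"
    using s by (subst lborel_integral_affine[of s _ k]) simp_all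
  also have "\<dots> = complex_of_real (s ^ DIM('a)) * (LINT u|lborel.
      complex_of_real ((sqrt (2 * pi) / s) ^ DIM('a)) * (f (k + s *\<^sub>R u) * complex_of_real (exp (- (norm u)\<^sup>2 / 2))))"
    using s by (simp add: scaleR_conv_of_real mult_ac)
  also have "\<dots> = complex_of_real (s ^ DIM('a) * (sqrt (2 * pi) / s) ^ DIM('a)) *
      (LINT u|lborel. f (k + s *\<^sub>R u) * complex_of_real (exp (- (norm u)\<^sup>2 / 2)))"
    by (simp only: integral_mult_right_zero of_real_mult mult.assoc)
  also have "s ^ DIM('a) * (sqrt (2 * pi) / s) ^ DIM('a) = sqrt (2 * pi) ^ DIM('a)"
    using s by (simp add: power_divide)
  finally show ?thesis
    unfolding h_def .
qed

text \<open>The Gaussian means act as an approximate identity: continuity gives the pointwise limit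
  of the integrand and \<open>b\<close> times the Gaussian dominates. The widths run through
  \<open>inverse (real (Suc n))\<close> because dominated convergence is applied to a
  sequence.\<close>

lemma gauss_mean_tendsto:
  fixes f :: "'a::euclidean_space \<Rightarrow> complex"
  assumes f: "continuous_on UNIV f" and b: "\<And>x. norm (f x) \<le> b"
  shows "(\<lambda>n. LINT u|lborel. f (k + inverse (real (Suc n)) *\<^sub>R u) * complex_of_real (exp (- (norm u)\<^sup>2 / 2)))
      \<longlonglongrightarrow> complex_of_real (sqrt (2 * pi) ^ DIM('a)) * f k"
proof -
  have [measurable]: "f \<in> borel_measurable borel"
    by (rule borel_measurable_continuous_onI[OF f])
  have "(\<lambda>n. LINT u|lborel. f (k + inverse (real (Suc n)) *\<^sub>R u) * complex_of_real (exp (- (norm u)\<^sup>2 / 2)))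
      \<longlonglongrightarrow> (LINT u|lborel. f k * complex_of_real (exp (- (norm (u::'a))\<^sup>2 / 2)))"
  proof (rule integral_dominated_convergence[where w = "\<lambda>u. b * exp (- (norm u)\<^sup>2 / 2)"])
    show "integrable lborel (\<lambda>u::'a. b * exp (- (norm u)\<^sup>2 / 2))"
      by (intro integrable_mult_right integrable_gauss)
    show "AE u in lborel. norm (f (k + inverse (real (Suc n)) *\<^sub>R u) * complex_of_real (exp (- (norm u)\<^sup>2 / 2)))
        \<le> b * exp (- (norm u)\<^sup>2 / 2)" for n
      by (intro AE_I2) (simp add: norm_mult b mult_right_mono)
    have "(\<lambda>n. f (k + inverse (real (Suc n)) *\<^sub>R u)) \<longlonglongrightarrow> f (k + 0 *\<^sub>R u)" for u
    proof -
      have "isCont f (k + 0 *\<^sub>R u)"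
        using f by (simp add: continuous_on_eq_continuous_at)
      then show ?thesis
        by (rule isCont_tendsto_compose) (intro tendsto_intros LIMSEQ_inverse_real_of_nat)
    qed
    then show "AE u in lborel. (\<lambda>n. f (k + inverse (real (Suc n)) *\<^sub>R u) * complex_of_real (exp (- (norm u)\<^sup>2 / 2)))
        \<longlonglongrightarrow> f k * complex_of_real (exp (- (norm u)\<^sup>2 / 2))"
      by (intro AE_I2 tendsto_mult tendsto_const) simp
  qed measurable
  also have "(LINT u|lborel. f k * complex_of_real (exp (- (norm (u::'a))\<^sup>2 / 2)))
      = complex_of_real (sqrt (2 * pi) ^ DIM('a)) * f k"
    using integral_iexp_gauss[of "0::'a"] by (simp add: mult.commute)
  finally show ?thesis .
qed

section \<open>Second differences of functions with compactly supported transform\<close>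

text \<open>The sum is \<open>2 cos \<theta> - 2\<close>, that is \<open>-4\<close> times the
  squared sine of \<open>\<theta> / 2\<close>, and the sine is at most its argument in
  modulus.\<close>

lemma norm_iexp_second_difference_le:
  "norm (iexp (- \<theta>) + iexp \<theta> - 2) \<le> \<theta>\<^sup>2"
proof -
  have "iexp (- \<theta>) + iexp \<theta> - 2 = complex_of_real (- (4 * (sin (\<theta> / 2))\<^sup>2))"
    using cos_double_sin[of "\<theta> / 2"]
    by (simp add: complex_eq_iff Re_exp Im_exp power2_eq_square)
  also have "norm \<dots> = 4 * \<bar>sin (\<theta> / 2)\<bar>\<^sup>2"
    unfolding norm_of_real by simp
  also have "\<dots> \<le> 4 * \<bar>\<theta> / 2\<bar>\<^sup>2"
    by (intro mult_left_mono power_mono abs_sin_x_le_abs_x) auto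
  finally show ?thesis
    by (simp add: power2_eq_square)
qed

text \<open>A bounded transform living on a ball has finite second moments, so the function it
  represents has second differences at the origin of quadratic size. The estimate is made for the
  Gaussian means \<open>J s\<close>, uniformly in \<open>s\<close>, and then passed to the
  limit.\<close>

lemma second_difference_bound_of_compactly_supported_fourier:
  fixes f :: "'a::euclidean_space \<Rightarrow> complex"
  assumes f: "integrable lborel f" and cont: "continuous_on UNIV f" and b: "\<And>x. norm (f x) \<le> b"
    and supp: "\<And>x. norm x \<ge> R \<Longrightarrow> (LINT l|lborel. iexp (x \<bullet> l) * f l) = 0"
  shows "\<exists>C. \<forall>k. norm (f k + f (- k) - 2 * f 0) \<le> C * (norm k)\<^sup>2"
proof -
  have fm [measurable]: "f \<in> borel_measurable borel"
    using borel_measurable_integrable[OF f] by simp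
  define F where "F x = (LINT l|lborel. iexp (x \<bullet> l) * f l)" for x
  have Fm [measurable]: "F \<in> borel_measurable borel"
    unfolding F_def by measurable
  define M where "M = (LINT l|lborel. norm (f l))"
  have FM: "norm (F x) \<le> M" for x
    unfolding F_def M_def by (rule order_trans[OF integral_norm_bound]) (simp add: norm_mult)
  have M0: "M \<ge> 0"
    using FM[of 0] norm_ge_zero order_trans by blast
  \<comment> \<open>This constant enters twice, from the summation formula and from the limit of the
    means; hence \<open>G\<^sup>2\<close> below.\<close>
  define G where "G = complex_of_real (sqrt (2 * pi) ^ DIM('a))"
  define V where "V = measure lborel (ball (0::'a) R)"
  define J where "J s k = (LINT u|lborel. f (k + s *\<^sub>R u) * complex_of_real (exp (- (norm u)\<^sup>2 / 2)))" for s k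
  have J: "norm (G * (J s k + J s (- k) - 2 * J s 0)) \<le> M * R\<^sup>2 * V * (norm k)\<^sup>2" if s: "s > 0" for s k
  proof -
    define E where "E m x = F x * (iexp (- (x \<bullet> m)) * complex_of_real (exp (- (norm (s *\<^sub>R x))\<^sup>2 / 2)))" for m x
    have E: "(LINT x|lborel. E m x) = G * J s m" for m
      unfolding E_def F_def G_def J_def by (rule fourier_gauss_summation[OF f s])
    have iE: "integrable lborel (E m)" for m
    proof (rule Bochner_Integration.integrable_bound[OF integrable_mult_right[OF integrable_scaled_gauss[OF s], of M]])
      show "E m \<in> borel_measurable lborel"
        unfolding E_def by measurable
    qed (auto simp: E_def norm_mult FM M0 intro!: mult_right_mono)
    have "G * (J s k + J s (- k) - 2 * J s 0) = (LINT x|lborel. E k x + E (- k) x - 2 * E 0 x)"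
      using iE by (simp add: E algebra_simps)
    also have "norm \<dots> \<le> (LINT x|lborel. norm (E k x + E (- k) x - 2 * E 0 x))"
      by (rule integral_norm_bound)
    also have "\<dots> \<le> (LINT x|lborel. indicator (ball (0::'a) R) x * (M * R\<^sup>2 * (norm k)\<^sup>2))"
    proof (rule integral_mono)
      show "integrable lborel (\<lambda>x. norm (E k x + E (- k) x - 2 * E 0 x))"
        using iE by (intro integrable_norm Bochner_Integration.integrable_diff Bochner_Integration.integrable_add) auto
      show "integrable lborel (\<lambda>x::'a. indicator (ball 0 R) x * (M * R\<^sup>2 * (norm k)\<^sup>2))"
        using emeasure_lborel_ball_finite[of "0::'a" R]
        by (intro integrable_mult_left integrable_real_indicator) auto
      fix x :: 'a
      have "E k x + E (- k) x - 2 * E 0 x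
          = F x * complex_of_real (exp (- (norm (s *\<^sub>R x))\<^sup>2 / 2)) * (iexp (- (x \<bullet> k)) + iexp (x \<bullet> k) - 2)"
        by (simp add: E_def algebra_simps)
      also have "norm \<dots> \<le> norm (F x) * 1 * (x \<bullet> k)\<^sup>2"
        unfolding norm_mult
        by (intro mult_mono norm_iexp_second_difference_le) auto
      \<comment> \<open>Inside the ball Cauchy-Schwarz controls \<open>x \<bullet> k\<close>;
        outside it \<open>F\<close> vanishes, so the growth of
        \<open>(x \<bullet> k)\<^sup>2\<close> does no harm.\<close>
      also have "\<dots> \<le> indicator (ball 0 R) x * (M * R\<^sup>2 * (norm k)\<^sup>2)"
      proof (cases "norm x < R")
        case True
        have "(x \<bullet> k)\<^sup>2 \<le> (norm x * norm k)\<^sup>2"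
          using Cauchy_Schwarz_ineq2[of x k] by (metis abs_le_square_iff abs_norm_cancel abs_mult)
        also have "\<dots> \<le> (R * norm k)\<^sup>2"
          using True by (intro power_mono mult_right_mono) auto
        finally have "norm (F x) * (x \<bullet> k)\<^sup>2 \<le> M * (R * norm k)\<^sup>2"
          by (intro mult_mono FM M0) auto
        then show ?thesis
          using True by (simp add: power_mult_distrib mult_ac)
      next
        case False
        then show ?thesis
          using supp[of x] by (simp add: F_def)
      qed
      finally show "norm (E k x + E (- k) x - 2 * E 0 x) \<le> indicator (ball 0 R) x * (M * R\<^sup>2 * (norm k)\<^sup>2)" .
    qed
    also have "\<dots> = M * R\<^sup>2 * V * (norm k)\<^sup>2"
      by (simp add: V_def)
    finally show ?thesis .
  qed
  have lim: "(\<lambda>n. J (inverse (real (Suc n))) k) \<longlonglongrightarrow> G * f k" for k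
    unfolding J_def G_def by (rule gauss_mean_tendsto[OF cont b])
  \<comment> \<open>The bound in \<open>J\<close> does not depend on \<open>s\<close>, so it
    survives the limit of shrinking widths.\<close>
  have "norm (G * (G * f k + G * f (- k) - 2 * (G * f 0))) \<le> M * R\<^sup>2 * V * (norm k)\<^sup>2" for k
  proof (rule LIMSEQ_le_const2)
    show "(\<lambda>n. norm (G * (J (inverse (real (Suc n))) k + J (inverse (real (Suc n))) (- k)
            - 2 * J (inverse (real (Suc n))) 0))) \<longlonglongrightarrow> norm (G * (G * f k + G * f (- k) - 2 * (G * f 0)))"
      by (intro tendsto_intros lim)
  qed (auto intro!: exI[of _ 0] J)
  moreover have "G * (G * f k + G * f (- k) - 2 * (G * f 0)) = G\<^sup>2 * (f k + f (- k) - 2 * f 0)" for k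
    by (simp add: power2_eq_square algebra_simps)
  ultimately have "norm (G\<^sup>2) * norm (f k + f (- k) - 2 * f 0) \<le> M * R\<^sup>2 * V * (norm k)\<^sup>2" for k
    by (simp only: norm_mult)
  moreover have "norm (G\<^sup>2) > 0"
    by (simp add: G_def)
  ultimately have "norm (f k + f (- k) - 2 * f 0) \<le> M * R\<^sup>2 * V / norm (G\<^sup>2) * (norm k)\<^sup>2" for k
    by (simp add: pos_le_divide_eq mult.commute)
  then show ?thesis
    by blast
qed

section \<open>Integrability of stretched exponentials\<close>

text \<open>The inequality \<open>y \<le> exp y\<close> at \<open>y = p * r powr s / q\<close>,
  raised to the power \<open>q\<close>.\<close>

lemma powr_le_exp:
  assumes "q > 0" "p > 0" "r \<ge> 0" and "s > (0::real)"
  shows "r powr (s * q) \<le> (q / p) powr q * exp (p * r powr s)"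
proof -
  have "p * r powr s / q \<le> exp (p * r powr s / q)"
    using exp_ge_add_one_self[of "p * r powr s / q"] by linarith
  then have "(p * r powr s / q) powr q \<le> exp (p * r powr s / q) powr q"
    using assms by (intro powr_mono2) auto
  also have "\<dots> = exp (p * r powr s)"
    using assms by (simp add: powr_def)
  finally have "(q / p) powr q * (p * r powr s / q) powr q \<le> (q / p) powr q * exp (p * r powr s)"
    by (rule mult_left_mono) simp
  moreover have "(q / p) powr q * (p * r powr s / q) powr q = r powr (s * q)"
    using assms by (simp add: powr_mult[symmetric] powr_powr)
  ultimately show ?thesis
    by simp
qed

lemma power_one_plus_le: "(1 + u) ^ n \<le> 2 ^ n * (1 + u ^ n)" if "u \<ge> (0::real)"
proof -
  have "(1 + u) ^ n \<le> (2 * max 1 u) ^ n"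
    using that by (intro power_mono) auto
  also have "\<dots> = 2 ^ n * max 1 u ^ n"
    by (rule power_mult_distrib)
  also have "max 1 u ^ n \<le> 1 + u ^ n"
    using that by (auto simp: max_def)
  finally show ?thesis
    by simp
qed

lemma integrable_prod_inverse_one_plus_square:
  "integrable lborel (\<lambda>x::'a::euclidean_space. \<Prod>b\<in>Basis. inverse (1 + (x \<bullet> b)\<^sup>2))"
  using integrable_inverse_1_plus_square
  by (intro integrable_lborel_prod) (simp add: set_integrable_def)

text \<open>The majorant is a product of functions \<open>inverse (1 + y\<^sup>2)\<close> of the
  coordinates. Its reciprocal is at most \<open>(1 + (norm x)\<^sup>2) ^ n\<close>, a polynomial in
  the norm, which the stretched exponential outgrows.\<close>

lemma integrable_exp_neg_norm_powr:
  assumes p: "p > 0" and s: "s > 0"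
  shows "integrable lborel (\<lambda>x::'a::euclidean_space. exp (- (p * norm x powr s)))"
proof -
  define n where "n = DIM('a)"
  \<comment> \<open>Chosen so that \<open>s * q = 2 * n\<close>, the degree of that
    polynomial.\<close>
  define q where "q = 2 * real n / s"
  have q: "q > 0"
    using s by (simp add: q_def n_def)
  define K where "K = 2 ^ n * (1 + (q / p) powr q)"
  have *: "exp (- (p * norm x powr s)) \<le> K * (\<Prod>b\<in>Basis. inverse (1 + (x \<bullet> b)\<^sup>2))" for x :: 'a
  proof -
    have "(\<Prod>b\<in>Basis. 1 + (x \<bullet> b)\<^sup>2) \<le> (\<Prod>b\<in>(Basis::'a set). 1 + (norm x)\<^sup>2)"
    proof (rule prod_mono, intro conjI)
      fix b :: 'a assume "b \<in> Basis"
      then have "\<bar>x \<bullet> b\<bar>\<^sup>2 \<le> (norm x)\<^sup>2"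
        by (intro power_mono Basis_le_norm) auto
      then show "1 + (x \<bullet> b)\<^sup>2 \<le> 1 + (norm x)\<^sup>2"
        by simp
    qed simp
    also have "\<dots> = (1 + (norm x)\<^sup>2) ^ n"
      by (simp add: n_def)
    also have "\<dots> \<le> 2 ^ n * (1 + ((norm x)\<^sup>2) ^ n)"
      by (rule power_one_plus_le) simp
    also have "((norm x)\<^sup>2) ^ n = norm x powr (s * q)"
    \<comment> \<open>Real and natural powers agree for a positive base; at the origin both sides
      are \<open>0\<close>, as the dimension is positive.\<close>
    proof (cases "x = 0")
      case False
      have "s * q = real (2 * n)"
        using s by (simp add: q_def)
      then show ?thesis
        using False by (simp only: powr_realpow zero_less_norm_iff power_mult not_False_eq_True)
    qed (simp add: n_def)
    also have "2 ^ n * (1 + norm x powr (s * q)) \<le> 2 ^ n * (exp (p * norm x powr s) + (q / p) powr q * exp (p * norm x powr s))"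
      using p s q by (intro mult_left_mono add_mono powr_le_exp) auto
    also have "\<dots> = K * exp (p * norm x powr s)"
      unfolding K_def by (simp only: distrib_left distrib_right mult_1_right mult_1 mult.assoc)
    finally have "(\<Prod>b\<in>Basis. 1 + (x \<bullet> b)\<^sup>2) \<le> K * exp (p * norm x powr s)" .
    moreover have "(\<Prod>b\<in>Basis. 1 + (x \<bullet> b)\<^sup>2) > 0"
      by (intro prod_pos) (auto intro: add_pos_nonneg)
    moreover have "(\<Prod>b\<in>Basis. inverse (1 + (x \<bullet> b)\<^sup>2)) = inverse (\<Prod>b\<in>Basis. 1 + (x \<bullet> b)\<^sup>2)"
      using prod_inversef[of "\<lambda>b. 1 + (x \<bullet> b)\<^sup>2" "Basis :: 'a set"] by (simp only: o_def)
    ultimately show ?thesis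
      by (simp only: exp_minus) (simp add: divide_simps mult.commute)
  qed
  show ?thesis
  proof (rule Bochner_Integration.integrable_bound)
    show "integrable lborel (\<lambda>x::'a. K * (\<Prod>b\<in>Basis. inverse (1 + (x \<bullet> b)\<^sup>2)))"
      by (intro integrable_mult_right integrable_prod_inverse_one_plus_square)
    show "AE x in lborel. norm (exp (- (p * norm (x::'a) powr s)))
        \<le> norm (K * (\<Prod>b\<in>Basis. inverse (1 + (x \<bullet> b)\<^sup>2)))"
      unfolding real_norm_def[of "_ * _"] using order_trans[OF * abs_ge_self]
      by (intro AE_I2) (simp only: real_norm_def abs_exp_cancel)
  qed measurable
qed

section \<open>The factor sin(B)/B and elementary estimates\<close>

text \<open>At \<open>0\<close> this is the derivative of the sine; away from \<open>0\<close> the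
  function is locally a plain quotient.\<close>

lemma continuous_on_sin_over: "continuous_on UNIV (\<lambda>b. sin_over b 1)"
proof (intro continuous_at_imp_continuous_on ballI)
  fix b :: complex
  show "isCont (\<lambda>b. sin_over b 1) b"
  proof (cases "b = 0")
    case True
    have "(\<lambda>h. (sin (0 + h) - sin 0) / h) \<midarrow>0\<rightarrow> cos (0::complex)"
      using DERIV_sin[of "0::complex"] by (simp only: DERIV_def)
    then have "(\<lambda>h. sin h / h) \<midarrow>0\<rightarrow> (1::complex)"
      by simp
    then have "(\<lambda>b. sin_over b 1) \<midarrow>0\<rightarrow> 1"
      by (rule Lim_transform_eventually) (simp add: sin_over_def eventually_at_filter)
    then show ?thesis
      using True by (simp add: isCont_def sin_over_def)
  next
    case False
    have "\<forall>\<^sub>F z in nhds b. sin_over z 1 = sin z / z"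
      using t1_space_nhds[OF False] by eventually_elim (simp add: sin_over_def)
    moreover have "isCont (\<lambda>z. sin z / z) b"
      using False by (intro continuous_intros)
    ultimately show ?thesis
      by (simp add: isCont_cong)
  qed
qed

text \<open>One formula for both signs of \<open>q\<close>, from which continuity along the real
  axis is visible although \<open>csqrt\<close> jumps across the negative half-line.\<close>

lemma csqrt_of_real_eq:
  "csqrt (complex_of_real q) = complex_of_real (sqrt (max 0 q)) + \<i> * complex_of_real (sqrt (max 0 (- q)))"
  by (cases "q \<ge> 0") (auto simp: csqrt_of_real_nonneg csqrt_of_real_nonpos max_def)

lemma sin_imaginary: "sin (\<i> * complex_of_real b) = \<i> * complex_of_real (sinh b)"
  by (simp add: complex_eq_iff Re_sin Im_sin sinh_field_def)

text \<open>Equivalent to \<open>1 - 2 * \<beta> \<le> exp (- 2 * \<beta>)\<close> after division by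
  \<open>exp \<beta>\<close>. It controls the growth of the symbol where \<open>symB\<close> is
  imaginary.\<close>

lemma sinh_le_mult_exp: "sinh \<beta> \<le> \<beta> * exp \<beta>" for \<beta> :: real
proof -
  have "exp \<beta> * (1 + - 2 * \<beta>) \<le> exp \<beta> * exp (- 2 * \<beta>)"
    by (intro mult_left_mono exp_ge_add_one_self) auto
  also have "\<dots> = exp (- \<beta>)"
    by (simp add: exp_add[symmetric])
  finally show ?thesis
    by (simp add: sinh_field_def algebra_simps)
qed

lemma sinh_le_quadratic: "sinh \<beta> \<le> \<beta> * (1 + \<beta> / 2)" if "0 \<le> \<beta>" "\<beta> \<le> 1" for \<beta> :: real
  using exp_bound[OF that] exp_ge_add_one_self[of "- \<beta>"]
  by (simp add: sinh_field_def algebra_simps power2_eq_square)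

lemma exp_neg_le: "exp (- a) \<le> 1 - a / 2" if "0 \<le> a" "a \<le> 1" for a :: real
proof -
  have "a * a \<le> a"
    using mult_left_mono[OF that(2,1)] by simp
  then have "1 \<le> (1 - a / 2) * (1 + a)"
    by (simp add: algebra_simps)
  also have "\<dots> \<le> (1 - a / 2) * exp a"
    using that by (intro mult_left_mono exp_ge_add_one_self) auto
  finally show ?thesis
    by (simp add: exp_minus field_simps)
qed

text \<open>The sign of the radicand decides whether \<open>symB\<close> is real (including zero) or
  imaginary. In the second case \<open>\<beta>\<close> is its modulus, and the displayed relation
  says that the squared moduli of \<open>symA\<close> and \<open>symB\<close> differ by
  \<open>(c0 * norm k)\<^sup>2\<close>.\<close>

lemma sin_over_symB_cases:
  assumes c0: "c0 > 0"
  obtains v where "sin_over (symB c0 \<alpha> \<gamma> k) 1 = complex_of_real v" "\<bar>v\<bar> \<le> 1"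
  | \<beta> where "\<beta> > 0" "\<beta>\<^sup>2 + (c0 * norm k)\<^sup>2 = (\<alpha> * c0 * norm k powr \<gamma>)\<^sup>2"
      "sin_over (symB c0 \<alpha> \<gamma> k) 1 = complex_of_real (sinh \<beta> / \<beta>)"
proof -
  define Q where "Q = (norm k)\<^sup>2 - \<alpha>\<^sup>2 * norm k powr (2 * \<gamma>)"
  have sq: "norm k powr (2 * \<gamma>) = (norm k powr \<gamma>)\<^sup>2"
    by (simp add: power2_eq_square powr_add[symmetric])
  show thesis
  proof (cases "Q \<ge> 0")
    case True
    define b where "b = c0 * sqrt Q"
    have "symB c0 \<alpha> \<gamma> k = complex_of_real b"
      using True by (simp add: symB_def Q_def b_def csqrt_of_real_eq)
    then have "sin_over (symB c0 \<alpha> \<gamma> k) 1 = complex_of_real (if b = 0 then 1 else sin b / b)"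
      by (simp add: sin_over_def sin_of_real)
    moreover have "\<bar>if b = 0 then 1 else sin b / b\<bar> \<le> 1"
      using abs_sin_x_le_abs_x[of b] by (simp add: field_simps)
    ultimately show thesis
      by (rule that(1))
  next
    case False
    define b where "b = c0 * sqrt (- Q)"
    have b: "b > 0"
      using False c0 by (simp add: b_def)
    have "symB c0 \<alpha> \<gamma> k = \<i> * complex_of_real b"
      using False by (simp add: symB_def Q_def b_def csqrt_of_real_eq)
    then have e: "sin_over (symB c0 \<alpha> \<gamma> k) 1 = complex_of_real (sinh b / b)"
      using b by (simp add: sin_over_def sin_imaginary)
    have "b\<^sup>2 + (c0 * norm k)\<^sup>2 = (\<alpha> * c0 * norm k powr \<gamma>)\<^sup>2"
      using False unfolding b_def Q_def sq by (simp add: power_mult_distrib algebra_simps)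
    with b e show thesis
      using that(2) by blast
  qed
qed

section \<open>The symbol at time 1: continuity, decay and its cusp at the origin\<close>

text \<open>The function under \<open>F3D\<close> in \<open>greenG\<close> at \<open>t = 1\<close>;
  this single time suffices for the contradiction.\<close>

definition green_symbol :: "real \<Rightarrow> real \<Rightarrow> real \<Rightarrow> real^3 \<Rightarrow> complex" where
  "green_symbol c0 \<alpha> \<gamma> k = exp (symA c0 \<alpha> \<gamma> k) * sin_over (symB c0 \<alpha> \<gamma> k) 1"

lemma continuous_on_green_symbol:
  assumes "\<gamma> > 0"
  shows "continuous_on UNIV (green_symbol c0 \<alpha> \<gamma>)"
proof -
  have B: "continuous_on UNIV (symB c0 \<alpha> \<gamma>)"
    unfolding symB_def[abs_def] csqrt_of_real_eq
    using assms by (intro continuous_intros continuous_on_powr') auto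
  have "continuous_on UNIV (\<lambda>k. exp (symA c0 \<alpha> \<gamma> k))"
    unfolding symA_def using assms by (intro continuous_intros continuous_on_powr') auto
  moreover have "continuous_on UNIV (\<lambda>k. sin_over (symB c0 \<alpha> \<gamma> k) 1)"
    by (rule continuous_on_compose2[OF continuous_on_sin_over B]) auto
  ultimately show ?thesis
    unfolding green_symbol_def[abs_def] by (intro continuous_on_mult)
qed

text \<open>The first exponential covers real \<open>symB\<close>, the second imaginary
  \<open>symB\<close>. There, with \<open>a\<close> the modulus of \<open>symA\<close>, the gap
  \<open>a - \<beta>\<close> equals \<open>(c0 * norm k)\<^sup>2 / (a + \<beta>)\<close>, and
  \<open>a + \<beta> \<le> 2 * a\<close>.\<close>

lemma norm_green_symbol_le:
  assumes c0: "c0 > 0" and \<alpha>: "\<alpha> > 0"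
  shows "norm (green_symbol c0 \<alpha> \<gamma> k)
      \<le> exp (- (\<alpha> * c0 * norm k powr \<gamma>)) + exp (- (c0 / (2 * \<alpha>) * norm k powr (2 - \<gamma>)))"
proof -
  define a where "a = \<alpha> * c0 * norm k powr \<gamma>"
  have a0: "a \<ge> 0"
    using c0 \<alpha> by (simp add: a_def)
  have A: "norm (exp (symA c0 \<alpha> \<gamma> k)) = exp (- a)"
    by (simp add: symA_def a_def)
  have "norm (green_symbol c0 \<alpha> \<gamma> k) \<le> exp (- a) + exp (- (c0 / (2 * \<alpha>) * norm k powr (2 - \<gamma>)))"
  proof (rule sin_over_symB_cases[OF c0, of \<alpha> \<gamma> k])
    fix v assume "sin_over (symB c0 \<alpha> \<gamma> k) 1 = complex_of_real v" "\<bar>v\<bar> \<le> 1"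
    then have "norm (green_symbol c0 \<alpha> \<gamma> k) \<le> exp (- a)"
      unfolding green_symbol_def norm_mult A by (simp add: mult_left_le)
    then show ?thesis
      by (simp add: add_increasing2)
  next
    fix \<beta> assume \<beta>: "\<beta> > 0" "\<beta>\<^sup>2 + (c0 * norm k)\<^sup>2 = (\<alpha> * c0 * norm k powr \<gamma>)\<^sup>2"
      and e: "sin_over (symB c0 \<alpha> \<gamma> k) 1 = complex_of_real (sinh \<beta> / \<beta>)"
    \<comment> \<open>At \<open>k = 0\<close> the relation in \<open>\<beta>\<close> would force
      \<open>\<beta> = 0\<close>.\<close>
    have k: "norm k > 0"
      using \<beta> by (cases "k = 0") auto
    have apos: "a > 0"
      using k c0 \<alpha> by (simp add: a_def)
    have sq: "\<beta>\<^sup>2 + (c0 * norm k)\<^sup>2 = a\<^sup>2"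
      using \<beta>(2) by (simp add: a_def)
    have "\<beta>\<^sup>2 \<le> a\<^sup>2"
      using sq by (smt (verit) zero_le_power2)
    then have \<beta>a: "\<beta> \<le> a"
      using a0 by (rule power2_le_imp_le)
    have "(c0 * norm k)\<^sup>2 = (a - \<beta>) * (a + \<beta>)"
      using sq by (simp add: algebra_simps power2_eq_square)
    also have "\<dots> \<le> (a - \<beta>) * (2 * a)"
      using \<beta>a by (intro mult_left_mono) auto
    finally have "(c0 * norm k)\<^sup>2 / (2 * a) \<le> a - \<beta>"
      using apos by (simp add: field_simps)
    moreover have "(c0 * norm k)\<^sup>2 / (2 * a) = c0 / (2 * \<alpha>) * norm k powr (2 - \<gamma>)"
      using k c0 \<alpha> by (simp add: a_def powr_diff power2_eq_square field_simps)
    ultimately have gap: "c0 / (2 * \<alpha>) * norm k powr (2 - \<gamma>) \<le> a - \<beta>"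
      by simp
    have "norm (green_symbol c0 \<alpha> \<gamma> k) = exp (- a) * (sinh \<beta> / \<beta>)"
      using \<beta>(1) unfolding green_symbol_def norm_mult A e norm_of_real by simp
    also have "\<dots> \<le> exp (- a) * exp \<beta>"
      using sinh_le_mult_exp[of \<beta>] \<beta>(1) by (intro mult_left_mono) (auto simp: field_simps)
    also have "\<dots> \<le> exp (- (c0 / (2 * \<alpha>) * norm k powr (2 - \<gamma>)))"
      using gap by (simp add: exp_add[symmetric])
    finally show ?thesis
      by (simp add: add_increasing)
  qed
  then show ?thesis
    unfolding a_def .
qed

text \<open>The exponential gives a drop of order \<open>norm k powr \<gamma>\<close> that sin(B)/B
  cannot make up. In the imaginary case \<open>sinh \<beta> / \<beta> \<le> exp (a / 2)\<close> uses
  up half of the exponent and \<open>exp_neg_le\<close> halves it again, hence the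
  \<open>4\<close>.\<close>

lemma Re_green_symbol_le:
  assumes c0: "c0 > 0" and \<alpha>: "\<alpha> > 0" and small: "\<alpha> * c0 * norm k powr \<gamma> \<le> 1"
  shows "Re (green_symbol c0 \<alpha> \<gamma> k) \<le> 1 - \<alpha> * c0 * norm k powr \<gamma> / 4"
proof -
  define a where "a = \<alpha> * c0 * norm k powr \<gamma>"
  have a: "0 \<le> a" "a \<le> 1"
    using c0 \<alpha> small by (simp_all add: a_def)
  have A: "exp (symA c0 \<alpha> \<gamma> k) = complex_of_real (exp (- a))"
    unfolding symA_def exp_of_real[symmetric] by (simp add: a_def)
  have "Re (green_symbol c0 \<alpha> \<gamma> k) \<le> 1 - a / 4"
  proof (rule sin_over_symB_cases[OF c0, of \<alpha> \<gamma> k])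
    fix v assume v: "sin_over (symB c0 \<alpha> \<gamma> k) 1 = complex_of_real v" "\<bar>v\<bar> \<le> 1"
    have "Re (green_symbol c0 \<alpha> \<gamma> k) = exp (- a) * v"
      unfolding green_symbol_def A v of_real_mult[symmetric] by simp
    also have "\<dots> \<le> exp (- a)"
      using v(2) by (simp add: mult_left_le)
    also have "\<dots> \<le> 1 - a / 2"
      using a by (rule exp_neg_le)
    finally show ?thesis
      using a by simp
  next
    fix \<beta> assume \<beta>: "\<beta> > 0" "\<beta>\<^sup>2 + (c0 * norm k)\<^sup>2 = (\<alpha> * c0 * norm k powr \<gamma>)\<^sup>2"
      and e: "sin_over (symB c0 \<alpha> \<gamma> k) 1 = complex_of_real (sinh \<beta> / \<beta>)"
    have "\<beta>\<^sup>2 \<le> a\<^sup>2"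
      using \<beta>(2) unfolding a_def[symmetric] by (smt (verit) zero_le_power2)
    then have \<beta>a: "\<beta> \<le> a"
      using a(1) by (rule power2_le_imp_le)
    have "Re (green_symbol c0 \<alpha> \<gamma> k) = exp (- a) * (sinh \<beta> / \<beta>)"
      unfolding green_symbol_def A e of_real_mult[symmetric] by simp
    also have "\<dots> \<le> exp (- a) * (1 + \<beta> / 2)"
      using sinh_le_quadratic[of \<beta>] \<beta>(1) order_trans[OF \<beta>a a(2)]
      by (intro mult_left_mono) (auto simp: divide_le_eq mult.commute)
    also have "\<dots> \<le> exp (- a) * (1 + a / 2)"
      using \<beta>a by simp
    also have "\<dots> \<le> exp (- a) * exp (a / 2)"
      by (intro mult_left_mono exp_ge_add_one_self) simp
    also have "\<dots> = exp (- (a / 2))"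
      by (simp add: exp_add[symmetric])
    also have "\<dots> \<le> 1 - a / 2 / 2"
      using a by (intro exp_neg_le) auto
    finally show ?thesis
      by simp
  qed
  then show ?thesis
    unfolding a_def .
qed

section \<open>Contradiction between the cusp and the quadratic bound\<close>

theorem theorem8:
  fixes c0 \<alpha>1 \<gamma> :: real
  assumes "c0 > 0" and "0 < \<alpha>1" and "\<alpha>1 < 1" and "0 < \<gamma>" and "\<gamma> < 2"
  shows "\<not> (\<exists>c>0. \<forall>t>0.
           closure {x. greenG c0 \<alpha>1 \<gamma> x t \<noteq> 0} \<subseteq> ball 0 (c * t))"
proof
  assume "\<exists>c>0. \<forall>t>0. closure {x. greenG c0 \<alpha>1 \<gamma> x t \<noteq> 0} \<subseteq> ball 0 (c * t)"
  then obtain c where "\<forall>t>0. closure {x. greenG c0 \<alpha>1 \<gamma> x t \<noteq> 0} \<subseteq> ball 0 (c * t)"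
    by blast
  then have "closure {x. greenG c0 \<alpha>1 \<gamma> x 1 \<noteq> 0} \<subseteq> ball 0 (c * 1)"
    by (rule allE[where x = 1]) simp
  then have G: "{x. greenG c0 \<alpha>1 \<gamma> x 1 \<noteq> 0} \<subseteq> ball 0 c"
    using order_trans[OF closure_subset] by (simp only: mult_1_right)
  \<comment> \<open>At \<open>t = 1\<close> the prefactors of \<open>greenG\<close> and
    \<open>F3D\<close> are nonzero, so the bare integral vanishes as well.\<close>
  have supp: "(LINT k|lborel. iexp (x \<bullet> k) * green_symbol c0 \<alpha>1 \<gamma> k) = 0" if "norm x \<ge> c" for x
  proof -
    have "x \<notin> ball 0 c"
      using that by simp
    then have "greenG c0 \<alpha>1 \<gamma> x 1 = 0"
      using G by blast
    then show ?thesis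
      using assms(1) by (simp add: greenG_def heaviside_def F3D_def green_symbol_def)
  qed
  define f where "f = green_symbol c0 \<alpha>1 \<gamma>"
  have cont: "continuous_on UNIV f"
    unfolding f_def by (rule continuous_on_green_symbol) fact
  note le = norm_green_symbol_le[OF assms(1,2), of \<gamma>, folded f_def]
  have bound: "norm (f k) \<le> 1 + 1" for k
    using assms by (intro order_trans[OF le] add_mono) auto
  have int: "integrable lborel f"
  proof (rule Bochner_Integration.integrable_bound)
    show "integrable lborel (\<lambda>k::real^3. exp (- (\<alpha>1 * c0 * norm k powr \<gamma>))
        + exp (- (c0 / (2 * \<alpha>1) * norm k powr (2 - \<gamma>))))"
      using assms by (intro Bochner_Integration.integrable_add integrable_exp_neg_norm_powr) auto
    show "f \<in> borel_measurable lborel"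
      using borel_measurable_continuous_onI[OF cont] by simp
    show "AE k in lborel. norm (f k) \<le> norm (exp (- (\<alpha>1 * c0 * norm k powr \<gamma>))
        + exp (- (c0 / (2 * \<alpha>1) * norm k powr (2 - \<gamma>))))"
      using le by (intro AE_I2) (auto intro: order_trans)
  qed
  obtain C where C: "norm (f k + f (- k) - 2 * f 0) \<le> C * (norm k)\<^sup>2" for k
    using second_difference_bound_of_compactly_supported_fourier[OF int cont bound supp[folded f_def]]
    by blast
  \<comment> \<open>\<open>symA\<close> and \<open>symB\<close> vanish at the origin, so the value
    is the one assigned by \<open>sin_over\<close> at \<open>0\<close>.\<close>
  have f0: "f 0 = 1"
    using assms(4) by (simp add: f_def green_symbol_def symA_def symB_def sin_over_def)
  have even: "f (- k) = f k" for k
    by (simp add: f_def green_symbol_def symA_def symB_def)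
  have lim: "((\<lambda>r. r powr p) \<longlongrightarrow> 0) (at_right 0)" if "p > 0" for p :: real
    using that by (intro tendsto_zero_powrI[where b = p]) (auto simp: eventually_at_right_less eventually_at_filter)
  have "((\<lambda>r. \<alpha>1 * c0 * r powr \<gamma>) \<longlongrightarrow> \<alpha>1 * c0 * 0) (at_right 0)"
    by (intro tendsto_mult tendsto_const lim) fact
  then have "\<forall>\<^sub>F r in at_right 0. \<alpha>1 * c0 * r powr \<gamma> < 1"
    by (rule order_tendstoD) simp
  moreover have "\<forall>\<^sub>F r in at_right 0. (r::real) > 0"
    by (rule eventually_at_right_less)
  \<comment> \<open>By evenness the second difference is twice \<open>f k - f 0\<close>, so its size
    lies between \<open>\<alpha>1 * c0 * r powr \<gamma> / 2\<close> and
    \<open>C * r\<^sup>2\<close>; cancelling \<open>r powr \<gamma>\<close> gives the claim.\<close>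
  ultimately have "\<forall>\<^sub>F r in at_right 0. \<alpha>1 * c0 / 2 \<le> C * r powr (2 - \<gamma>)"
  proof eventually_elim
    case (elim r)
    obtain k :: "real^3" where k: "norm k = r"
      using vector_choose_size[of r] elim by auto
    have "2 * (\<alpha>1 * c0 * r powr \<gamma> / 4) \<le> 2 * (1 - Re (f k))"
      using Re_green_symbol_le[OF assms(1,2), of k \<gamma>] elim k by (simp add: f_def)
    also have "\<dots> = - Re (f k + f (- k) - 2 * f 0)"
      by (simp add: even f0)
    also have "\<dots> \<le> norm (f k + f (- k) - 2 * f 0)"
      using abs_Re_le_cmod[of "f k + f (- k) - 2 * f 0"] by linarith
    also have "\<dots> \<le> C * r\<^sup>2"
      using C[of k] k by simp
    also have "r\<^sup>2 = r powr (2 - \<gamma>) * r powr \<gamma>"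
      using elim by (simp add: powr_add[symmetric])
    finally have "r powr \<gamma> * (\<alpha>1 * c0 / 2) \<le> r powr \<gamma> * (C * r powr (2 - \<gamma>))"
      by (simp add: mult_ac)
    then show ?case
      using elim by simp
  qed
  \<comment> \<open>Here \<open>\<gamma> < 2\<close> makes the right-hand side vanish in the limit,
    while the left-hand side is a positive constant.\<close>
  moreover have "((\<lambda>r. C * r powr (2 - \<gamma>)) \<longlongrightarrow> C * 0) (at_right 0)"
    using assms(5) by (intro tendsto_mult tendsto_const lim) simp
  ultimately have "\<alpha>1 * c0 / 2 \<le> C * 0"
    by (intro tendsto_lowerbound) auto
  then show False
    using assms(1,2) by (simp add: mult_le_0_iff)
qed

end
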